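(* Let $m,n\in\mathbb{N}$ and let $0<\alpha_i,\beta_j,\lambda_{ij}\le 1$ ($1\le i\le m$, $1\le j\le n$) be real numbers such that $\sum_{j=1}^n\lambda_{ij}=\alpha_i$ for all $i$, $\sum_{i=1}^m\lambda_{ij}=\beta_j$ for all $j$, and $\sum_{i=1}^m\sum_{j=1}^n\lambda_{ij}=\sum_{i=1}^m\alpha_i=\sum_{j=1}^n\beta_j\le 1$. Let $$g(t)=\frac{\prod_{i=1}^m\Gamma(\alpha_i t+1)\prod_{j=1}^n\Gamma(\beta_j t+1)}{\prod_{i=1}^m\prod_{j=1}^n\Gamma(\lambda_{ij}t+1)}.$$ Let $\nu\in\mathbb{N}$. For all $k\in\{1,\dots,\nu\}$ let $t_k\in(0,\infty)$ and $\mu_k\in(0,1)$ be such that $\sum_{k=1}^\nu\mu_k=1$. Then the following hold. (a) $g\big(\sum_{k=1}^\nu\mu_k t_k\big)\le\prod_{k=1}^\nu g(t_k)^{\mu_k}$, where equality holds if and only if all the $t_k$'s are the same. (b) $\prod_{k=1}^\nu g(t_k)<g\big(\sum_{k=1}^\nu t_k\big)$. (c) If $\nu\ge 3$ and $t_1\le t_3$, then $g(t_1+t_2)\,g(t_3)\le g(t_1)\,g(t_2+t_3)$, where equality holds if and only if $t_1=t_3$. Moreover, in terms of multinomial coefficients: (a') If in addition $\mu_k=1/\nu$ for all $k$, and $\bar t=\frac1\nu\sum_{k=1}^\nu t_k$, then $$\prod_{i=1}^m\binom{\alpha_i\bar t}{\lambda_{i1}\bar t,\dots,\lambda_{in}\bar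 t}\prod_{j=1}^n\binom{\beta_j\bar t}{\lambda_{1j}\bar t,\dots,\lambda_{mj}\bar t}\prod_{i=1}^m\prod_{j=1}^n\binom{\lambda_{ij}\bar t}{\lambda_{ij}\frac{t_1}{\nu},\lambda_{ij}\frac{t_2}{\nu},\dots,\lambda_{ij}\frac{t_\nu}{\nu}}$$ $$\le\prod_{k=1}^\nu\left[\prod_{i=1}^m\binom{\alpha_i t_k}{\lambda_{i1}t_k,\dots,\lambda_{in}t_k}\prod_{j=1}^n\binom{\beta_j t_k}{\lambda_{1j}t_k,\dots,\lambda_{mj}t_k}\prod_{i=1}^m\prod_{j=1}^n\binom{\lambda_{ij}t_k}{\lambda_{ij}\frac{t_k}{\nu},\dots,\lambda_{ij}\frac{t_k}{\nu}}\right]^{1/\nu},$$ where the last multinomial coefficient has $\nu$ lower entries, all equal to $\lambda_{ij}t_k/\nu$, and equality holds if and only if all the $t_k$'s are the same. (b') With $T=\sum_{k=1}^\nu t_k$, $$\prod_{k=1}^\nu\left[\prod_{i=1}^m\binom{\alpha_i t_k}{\lambda_{i1}t_k,\dots,\lambda_{in}t_k}\prod_{j=1}^n\binom{\beta_j t_k}{\lambda_{1j}t_k,\dots,\lambda_{mj}t_k}\right]$$ $$\le\prod_{i=1}^m\binom{\alpha_i T}{\lambda_{i1}T,\dots,\lambda_{in}T}\prod_{j=1}^n\binom{\beta_j T}{\lambda_{1j}T,\dots,\lambda_{mj}T}\prod_{i=1}^m\prod_{j=1}^n\binom{\lambda_{ij}T}{\lambda_{ij}t_1,\lambda_{ij}t_2,\dots,\lambda_{ij}t_\nu}.$$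 (c') If $\nu\ge 3$ and $t_1\le t_3$, then $$\prod_{i=1}^m\left[\binom{\alpha_i(t_1+t_2)}{\lambda_{i1}(t_1+t_2),\dots,\lambda_{in}(t_1+t_2)}\binom{\alpha_i t_3}{\lambda_{i1}t_3,\dots,\lambda_{in}t_3}\right]$$ $$\cdot\prod_{j=1}^n\left[\binom{\beta_j(t_1+t_2)}{\lambda_{1j}(t_1+t_2),\dots,\lambda_{mj}(t_1+t_2)}\binom{\beta_j t_3}{\lambda_{1j}t_3,\dots,\lambda_{mj}t_3}\right]\cdot\prod_{i=1}^m\prod_{j=1}^n\binom{\lambda_{ij}(t_1+t_2+t_3)}{\lambda_{ij}t_1,\ \lambda_{ij}(t_2+t_3)}$$ $$\le\prod_{i=1}^m\left[\binom{\alpha_i t_1}{\lambda_{i1}t_1,\dots,\lambda_{in}t_1}\binom{\alpha_i(t_2+t_3)}{\lambda_{i1}(t_2+t_3),\dots,\lambda_{in}(t_2+t_3)}\right]$$ $$\cdot\prod_{j=1}^n\left[\binom{\beta_j t_1}{\lambda_{1j}t_1,\dots,\lambda_{mj}t_1}\binom{\beta_j(t_2+t_3)}{\lambda_{1j}(t_2+t_3),\dots,\lambda_{mj}(t_2+t_3)}\right]\cdot\prod_{i=1}^m\prod_{j=1}^n\binom{\lambda_{ij}(t_1+t_2+t_3)}{\lambda_{ij}(t_1+t_2),\ \lambda_{ij}t_3},$$ where equality holds if and only if $t_1=t_3$.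
   Context: $\mathbb{N}=\{1,2,\dots\}$. $\Gamma$ is Euler's gamma function, $\Gamma(z)=\int_0^\infty u^{z-1}e^{-u}\,du$ for $z>0$. For real $x_1,\dots,x_r>0$ and $x=x_1+\dots+x_r$, the (generalized) multinomial coefficient is $\binom{x}{x_1,\dots,x_r}=\Gamma(x+1)/\prod_{s=1}^r\Gamma(x_s+1)$. *)

theory Defs
  imports "HOL-Analysis.Analysis"
begin

text \<open>
  Generalized multinomial coefficient with upper entry \<open>x\<close> and lower entries \<open>xs\<close>.
  The definition is meant for positive lower entries with \<open>x = sum_list xs\<close>; the upper entry
  is nevertheless kept as an explicit argument, as in the usual notation.
\<close>

definition gmultinomial :: "real \<Rightarrow> real list \<Rightarrow> real" where
  "gmultinomial x xs = Gamma (x + 1) / (\<Prod>y\<leftarrow>xs. Gamma (y + 1))"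

end

theory Submission
  imports Defs "HOL-Real_Asymp.Real_Asymp"
begin

text \<open>
  For positive \<open>c\<^sub>1, \<dots>, c\<^sub>n\<close> with sum \<open>s\<close>, monotonicity of \<open>x \<mapsto> x \<cdot> Polygamma 1 (x + 1)\<close> shows that
  \<open>ln \<Gamma>(s u + 1) - \<Sum>\<^sub>j ln \<Gamma>(c\<^sub>j u + 1)\<close> is convex in \<open>u\<close>. Hence the row factors of \<open>g\<close>
  already compensate the whole denominator, and the column factors make \<open>ln g\<close> strictly convex
  on \<open>[0, \<infinity>)\<close>, with \<open>ln g 0 = 0\<close>. The inequalities for \<open>g\<close> are then Jensen's inequality,
  superadditivity, and monotonicity of increments. The multinomial versions are the same
  inequalities with both sides multiplied by a common positive factor, because the product of all
  the row and column multinomials at \<open>u\<close> is \<open>g u / \<Prod>\<^sub>i\<^sub>j \<Gamma>(\<Lambda> i j u + 1)\<close>.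
\<close>

section \<open>Bounds on \<open>Polygamma 1\<close> and \<open>Polygamma 2\<close>, and what they
  give for sums\<close>

text \<open>Termwise comparison of the series with a telescoping one: the trapezoidal rule for \<open>1 / x\<^sup>2\<close>
  here, the midpoint rule for \<open>1 / x ^ 3\<close> in the next lemma.\<close>

lemma Polygamma_1_lower_bound:
  fixes x :: real
  assumes "0 < x"
  shows "1 / x + 1 / (2 * x\<^sup>2) \<le> Polygamma 1 x"
proof -
  define \<Phi> where "\<Phi> = (\<lambda>k::nat. 1 / (x + real k) + 1 / (2 * (x + real k)\<^sup>2))"
  have "\<Phi> \<longlonglongrightarrow> 0"
    unfolding \<Phi>_def by real_asymp
  then have tel: "(\<lambda>k. \<Phi> k - \<Phi> (Suc k)) sums \<Phi> 0"
    using telescope_sums'[of \<Phi> 0] by simp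
  have ser: "(\<lambda>k. inverse ((x + real k)\<^sup>2)) sums Polygamma 1 x"
    using Polygamma_LIMSEQ[of x 1] assms by (simp add: numeral_2_eq_2)
  have "\<Phi> k - \<Phi> (Suc k) \<le> inverse ((x + real k)\<^sup>2)" for k
  proof -
    define z where "z = x + real k"
    have "z > 0" using assms by (simp add: z_def add_pos_nonneg)
    \<comment> \<open>With a = 1 / z and b = 1 / (z + 1) one has a - b = a * b, so the trapezoidal
      error (a^2 + b^2) / 2 - (a - b) equals (a - b)^2 / 2.\<close>
    have "inverse (z\<^sup>2) - (1 / z + 1 / (2 * z\<^sup>2) - (1 / (z + 1) + 1 / (2 * (z + 1)\<^sup>2)))
        = (1 / z - 1 / (z + 1))\<^sup>2 / 2"
      using \<open>z > 0\<close> by (simp add: divide_simps) algebra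
    moreover have "0 \<le> (1 / z - 1 / (z + 1))\<^sup>2 / 2" by simp
    ultimately have "1 / z + 1 / (2 * z\<^sup>2) - (1 / (z + 1) + 1 / (2 * (z + 1)\<^sup>2)) \<le> inverse (z\<^sup>2)"
      by linarith
    moreover have "x + real k = z" "x + real (Suc k) = z + 1" by (simp_all add: z_def)
    ultimately show ?thesis unfolding \<Phi>_def by (simp only:)
  qed
  then have "\<Phi> 0 \<le> Polygamma 1 x"
    using sums_le[OF _ tel ser] by blast
  then show ?thesis by (simp add: \<Phi>_def)
qed

lemma Polygamma_2_lower_bound:
  fixes x :: real
  assumes "1 / 2 < x"
  shows "- 1 / (x - 1 / 2)\<^sup>2 \<le> Polygamma 2 x"
proof -
  define \<Phi> where "\<Phi> = (\<lambda>k::nat. 1 / (2 * (x - 1 / 2 + real k)\<^sup>2))"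
  have "\<Phi> \<longlonglongrightarrow> 0"
    unfolding \<Phi>_def by real_asymp
  then have tel: "(\<lambda>k. \<Phi> k - \<Phi> (Suc k)) sums \<Phi> 0"
    using telescope_sums'[of \<Phi> 0] by simp
  \<comment> \<open>The series of \<open>Polygamma 2\<close> carries the factor (-1)^3 * 2! =
    -2.\<close>
  have ser: "(\<lambda>k. inverse ((x + real k) ^ 3)) sums (- Polygamma 2 x / 2)"
    using Polygamma_LIMSEQ[of x 2] assms by (simp add: numeral_3_eq_3 numeral_2_eq_2)
  have "inverse ((x + real k) ^ 3) \<le> \<Phi> k - \<Phi> (Suc k)" for k
  proof -
    define z where "z = x + real k"
    have "z > 1 / 2" using assms by (simp add: z_def)
    \<comment> \<open>\<open>w\<close> and \<open>w + 1\<close> are the ends of the unit interval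
      centred at \<open>z\<close>; the integral of 1 / x^3 over it is the difference in
      \<open>eq\<close>.\<close>
    define w where "w = z - 1 / 2"
    have w: "w > 0" "z = w + 1 / 2" using \<open>z > 1 / 2\<close> by (simp_all add: w_def)
    have eq: "1 / (2 * w\<^sup>2) - 1 / (2 * (w + 1)\<^sup>2) = (w + 1 / 2) / (w * (w + 1))\<^sup>2"
      using w(1) by (simp add: divide_simps power2_eq_square) (simp add: algebra_simps)
    \<comment> \<open>Here w * (w + 1) = z^2 - 1/4, which puts the midpoint value below the
      integral.\<close>
    have "(w * (w + 1))\<^sup>2 \<le> (z\<^sup>2)\<^sup>2"
      using w by (intro power_mono) (auto simp: power2_eq_square algebra_simps)
    then have "z / (z\<^sup>2)\<^sup>2 \<le> z / (w * (w + 1))\<^sup>2"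
      using w by (intro divide_left_mono mult_pos_pos) auto
    moreover have "inverse (z ^ 3) = z / (z\<^sup>2)\<^sup>2"
      using w by (simp add: field_simps power2_eq_square power3_eq_cube)
    moreover have "x - 1 / 2 + real k = w" "x - 1 / 2 + real (Suc k) = w + 1"
      by (simp_all add: z_def w_def)
    ultimately show ?thesis unfolding \<Phi>_def using eq w(2) by (simp only: z_def[symmetric])
  qed
  then have "- Polygamma 2 x / 2 \<le> \<Phi> 0"
    using sums_le[OF _ ser tel] by blast
  then show ?thesis by (simp add: \<Phi>_def)
qed

text \<open>The derivative is \<open>Polygamma 1 (y + 1) + y * Polygamma 2 (y + 1)\<close>. When the
  two lower bounds are combined, the leading terms 1 / y cancel for large y, and a rational function
  with positive coefficients remains.\<close>

lemma mult_Polygamma_1_mono: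
  fixes a b :: real
  assumes "0 \<le> a" "a \<le> b"
  shows "a * Polygamma 1 (a + 1) \<le> b * Polygamma 1 (b + 1)"
proof (rule DERIV_nonneg_imp_nondecreasing[OF assms(2)])
  fix y assume "a \<le> y" "y \<le> b"
  then have y: "y \<ge> 0" using assms by simp
  then have "y + 1 \<notin> \<int>\<^sub>\<le>\<^sub>0" by (auto elim!: nonpos_Ints_cases)
  then have D: "((\<lambda>y. y * Polygamma 1 (y + 1)) has_real_derivative
      Polygamma 1 (y + 1) + y * Polygamma 2 (y + 1)) (at y)"
    by (auto intro!: derivative_eq_intros simp: numeral_2_eq_2)
  have "y / (y + 1 / 2)\<^sup>2 \<le> 1 / (y + 1) + 1 / (2 * (y + 1)\<^sup>2)"
  proof -
    have "1 / (y + 1) + 1 / (2 * (y + 1)\<^sup>2) - y / (y + 1 / 2)\<^sup>2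
        = (4 * y\<^sup>2 + 6 * y + 3) / (8 * (y + 1)\<^sup>2 * (y + 1 / 2)\<^sup>2)"
      using y by (simp add: divide_simps) algebra
    moreover have "0 \<le> (4 * y\<^sup>2 + 6 * y + 3) / (8 * (y + 1)\<^sup>2 * (y + 1 / 2)\<^sup>2)"
      using y by simp
    ultimately show ?thesis by linarith
  qed
  also have "\<dots> \<le> Polygamma 1 (y + 1)"
    using Polygamma_1_lower_bound[of "y + 1"] y by simp
  finally have "y / (y + 1 / 2)\<^sup>2 \<le> Polygamma 1 (y + 1)" .
  moreover have "y * (- 1 / (y + 1 / 2)\<^sup>2) \<le> y * Polygamma 2 (y + 1)"
    using Polygamma_2_lower_bound[of "y + 1"] y by (intro mult_left_mono) (simp_all add: algebra_simps)
  ultimately show "\<exists>z. ((\<lambda>y. y * Polygamma 1 (y + 1)) has_real_derivative z) (at y) \<and> 0 \<le> z"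
    using D by force
qed

text \<open>Each summand is the second derivative of ln Gamma (\<open>c x * u + 1\<close>) in
  \<open>u\<close>. As \<open>c x\<close> is at most the total, \<open>mult_Polygamma_1_mono\<close>
  compares \<open>c x * Polygamma 1 (c x * u + 1)\<close> with the same expression at the total;
  weighting by \<open>c x\<close> and summing produces the square.\<close>

lemma sum_square_mult_Polygamma_1_le:
  fixes u :: real
  assumes "finite A" "\<And>x. x \<in> A \<Longrightarrow> 0 \<le> c x" "0 \<le> u"
  shows "(\<Sum>x\<in>A. (c x)\<^sup>2 * Polygamma 1 (c x * u + 1))
    \<le> (sum c A)\<^sup>2 * Polygamma 1 (sum c A * u + 1)"
proof -
  define s where "s = sum c A"
  have "c x * Polygamma 1 (c x * u + 1) \<le> s * Polygamma 1 (s * u + 1)" if "x \<in> A" for x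
  proof -
    have le: "c x \<le> s"
      unfolding s_def using assms that by (intro member_le_sum) auto
    have c: "0 \<le> c x" using assms that by blast
    show ?thesis
    \<comment> \<open>Monotonicity compares quantities with an extra factor \<open>u\<close>, which
      cannot be cancelled at 0; there the claim is \<open>c x \<le> s\<close> times a positive
      constant.\<close>
    proof (cases "u = 0")
      case True
      have "Polygamma 1 (1::real) > 0"
        by (rule Polygamma_real_odd_pos) auto
      with True le show ?thesis by simp
    next
      case False
      with \<open>0 \<le> u\<close> have "u > 0" by simp
      have "(c x * u) * Polygamma 1 (c x * u + 1) \<le> (s * u) * Polygamma 1 (s * u + 1)"
        using le c \<open>u > 0\<close> by (intro mult_Polygamma_1_mono mult_right_mono) auto
      then have "u * (c x * Polygamma 1 (c x * u + 1)) \<le> u * (s * Polygamma 1 (s * u + 1))"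
        by (simp add: mult_ac)
      with \<open>u > 0\<close> show ?thesis by simp
    qed
  qed
  then have "(\<Sum>x\<in>A. c x * (c x * Polygamma 1 (c x * u + 1)))
      \<le> (\<Sum>x\<in>A. c x * (s * Polygamma 1 (s * u + 1)))"
    using assms by (intro sum_mono mult_left_mono) auto
  also have "\<dots> = s * (s * Polygamma 1 (s * u + 1))"
    by (simp add: sum_distrib_right[symmetric] s_def)
  finally show ?thesis
    by (simp add: s_def power2_eq_square mult_ac)
qed

section \<open>Strict convexity on [0, \<infinity>) and its consequences\<close>

text \<open>Strict convexity is expressed through the derivative, so that tangent lines and
  derivative tests yield the inequalities below together with their strictness.\<close>

locale strictly_increasing_deriv =
  fixes f f' :: "real \<Rightarrow> real"
  assumes deriv: "0 \<le> x \<Longrightarrow> (f has_real_derivative f' x) (at x)"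
    and deriv_less: "0 \<le> x \<Longrightarrow> x < y \<Longrightarrow> f' x < f' y"
begin

text \<open>The mean value theorem turns the chord slope into \<open>f'\<close> at a point strictly
  between, and strict monotonicity of \<open>f'\<close> decides on either side.\<close>

lemma above_tangent:
  assumes "0 \<le> x" "0 \<le> y" "x \<noteq> y"
  shows "f x + f' x * (y - x) < f y"
proof (cases "x < y")
  case True
  obtain z where "x < z" "z < y" "f y - f x = (y - x) * f' z"
    using MVT2[OF True, of f f'] deriv assms by force
  moreover have "(y - x) * f' x < (y - x) * f' z"
    using True \<open>x < z\<close> assms deriv_less by simp
  ultimately show ?thesis by (simp only: mult.commute)
next
  case False
  then have "y < x" using assms by simp
  obtain z where "y < z" "z < x" "f x - f y = (x - y) * f' z"
    using MVT2[OF \<open>y < x\<close>, of f f'] deriv assms by force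
  moreover have "(x - y) * f' z < (x - y) * f' x"
    using \<open>y < x\<close> \<open>y < z\<close> \<open>z < x\<close> assms deriv_less by simp
  ultimately show ?thesis by (simp add: algebra_simps)
qed

text \<open>All values are compared with the tangent at the weighted mean \<open>c\<close>, whose
  weighted sum is exactly \<open>f c\<close>. Any \<open>x k\<close> off the mean makes its
  comparison strict, which settles equality.\<close>

lemma jensen:
  assumes "finite A" "sum w A = 1"
    and "\<And>k. k \<in> A \<Longrightarrow> 0 < w k" "\<And>k. k \<in> A \<Longrightarrow> 0 \<le> x k"
  shows "f (\<Sum>k\<in>A. w k * x k) \<le> (\<Sum>k\<in>A. w k * f (x k))"
    and "f (\<Sum>k\<in>A. w k * x k) = (\<Sum>k\<in>A. w k * f (x k)) \<longleftrightarrow> (\<forall>k\<in>A. \<forall>l\<in>A. x k = x l)"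
proof -
  define c where "c = (\<Sum>k\<in>A. w k * x k)"
  have "0 \<le> c"
    unfolding c_def using assms by (intro sum_nonneg mult_nonneg_nonneg) (auto simp: less_imp_le)
  have tangent: "f c = (\<Sum>k\<in>A. w k * (f c + f' c * (x k - c)))"
  proof -
    have "(\<Sum>k\<in>A. w k * (f c + f' c * (x k - c)))
        = (\<Sum>k\<in>A. w k * (f c - f' c * c)) + (\<Sum>k\<in>A. f' c * (w k * x k))"
      by (simp add: sum.distrib[symmetric] algebra_simps)
    also have "\<dots> = sum w A * (f c - f' c * c) + f' c * c"
      by (simp only: sum_distrib_left[symmetric] sum_distrib_right[symmetric] c_def)
    also have "\<dots> = f c" using assms by simp
    finally show ?thesis by simp
  qed
  have le: "w k * (f c + f' c * (x k - c)) \<le> w k * f (x k)" if "k \<in> A" for k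
    using above_tangent[of c "x k"] that assms \<open>0 \<le> c\<close>
    by (cases "x k = c") (auto intro!: mult_left_mono simp: less_imp_le)
  show "f (\<Sum>k\<in>A. w k * x k) \<le> (\<Sum>k\<in>A. w k * f (x k))"
    unfolding c_def[symmetric] using le by (subst tangent) (rule sum_mono)
  show "f (\<Sum>k\<in>A. w k * x k) = (\<Sum>k\<in>A. w k * f (x k)) \<longleftrightarrow> (\<forall>k\<in>A. \<forall>l\<in>A. x k = x l)"
  proof
    assume eq: "f (\<Sum>k\<in>A. w k * x k) = (\<Sum>k\<in>A. w k * f (x k))"
    have "x k = c" if "k \<in> A" for k
    proof (rule ccontr)
      assume "x k \<noteq> c"
      then have "w k * (f c + f' c * (x k - c)) < w k * f (x k)"
        using above_tangent[of c "x k"] that assms \<open>0 \<le> c\<close> by auto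
      then have "(\<Sum>k\<in>A. w k * (f c + f' c * (x k - c))) < (\<Sum>k\<in>A. w k * f (x k))"
        using le that assms by (intro sum_strict_mono_ex1) auto
      with eq tangent show False by (simp add: c_def)
    qed
    then show "\<forall>k\<in>A. \<forall>l\<in>A. x k = x l" by simp
  next
    assume const: "\<forall>k\<in>A. \<forall>l\<in>A. x k = x l"
    have "A \<noteq> {}" using assms by auto
    then obtain a where "a \<in> A" by blast
    with const have x: "x k = x a" if "k \<in> A" for k using that by blast
    have "(\<Sum>k\<in>A. w k * h (x k)) = h (x a)" for h :: "real \<Rightarrow> real"
    proof -
      have "(\<Sum>k\<in>A. w k * h (x k)) = sum w A * h (x a)"
        unfolding sum_distrib_right by (rule sum.cong) (auto simp: x)
      with assms show ?thesis by simp
    qed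
    from this[of "\<lambda>v. v"] this[of f]
    show "f (\<Sum>k\<in>A. w k * x k) = (\<Sum>k\<in>A. w k * f (x k))" by simp
  qed
qed

lemma star_shaped:
  assumes "f 0 = 0" "0 < x" "x < y"
  shows "f x < x / y * f y"
proof -
  have tangent: "f x + f' x * (0 - x) < f 0" "f x + f' x * (y - x) < f y"
    using above_tangent[of x 0] above_tangent[of x y] assms by simp_all
  \<comment> \<open>The weights \<open>y - x\<close> and \<open>x\<close> make the slope terms
    cancel.\<close>
  have "(y - x) * (f x + f' x * (0 - x)) + x * (f x + f' x * (y - x))
      < (y - x) * f 0 + x * f y"
    using tangent assms by (intro add_strict_mono mult_strict_left_mono) auto
  then have "y * f x < x * f y"
    using assms by (simp add: algebra_simps)
  with assms show ?thesis by (simp add: field_simps)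
qed

text \<open>By \<open>star_shaped\<close>, each term is less than the share \<open>x k / s\<close>
  of \<open>f s\<close>, and the shares add up to 1. The second index ensures that
  \<open>x k\<close> lies strictly below the total.\<close>

lemma sum_less:
  assumes "f 0 = 0" "finite A" "2 \<le> card A" "\<And>k. k \<in> A \<Longrightarrow> 0 < x k"
  shows "(\<Sum>k\<in>A. f (x k)) < f (sum x A)"
proof -
  define s where "s = sum x A"
  have "A \<noteq> {}" using assms by auto
  then have "s > 0" unfolding s_def using assms by (intro sum_pos) auto
  have less: "x k < s" if "k \<in> A" for k
  proof -
    have "A - {k} \<noteq> {}"
      using assms that by (metis One_nat_def Suc_1 card.empty card_Diff_singleton diff_is_0_eq not_less_eq_eq)
    then have "0 < sum x (A - {k})" using assms by (intro sum_pos) auto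
    then show ?thesis
      using assms that by (simp add: s_def sum.remove)
  qed
  have "(\<Sum>k\<in>A. f (x k)) < (\<Sum>k\<in>A. x k / s * f s)"
    using assms \<open>A \<noteq> {}\<close> less by (intro sum_strict_mono star_shaped) auto
  also have "\<dots> = sum x A / s * f s"
    by (simp add: sum_distrib_right sum_divide_distrib)
  also have "\<dots> = f s" using \<open>s > 0\<close> by (simp add: s_def)
  finally show ?thesis by (simp add: s_def)
qed

text \<open>The increment over length \<open>h\<close> has the positive derivative
  \<open>f' (z + h) - f' z\<close>.\<close>

lemma increment_less:
  assumes "0 \<le> x" "x < y" "0 < h"
  shows "f (x + h) - f x < f (y + h) - f y"
proof (rule DERIV_pos_imp_increasing[OF \<open>x < y\<close>])
  fix z assume "x \<le> z" "z \<le> y"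
  then have "0 \<le> z" using assms by simp
  have "((\<lambda>z. f (z + h)) has_real_derivative f' (z + h)) (at z)"
    using deriv[of "z + h"] \<open>0 \<le> z\<close> assms by (simp add: DERIV_shift)
  then have "((\<lambda>z. f (z + h) - f z) has_real_derivative f' (z + h) - f' z) (at z)"
    using deriv[OF \<open>0 \<le> z\<close>] by (rule DERIV_diff)
  moreover have "0 < f' (z + h) - f' z"
    using deriv_less[of z "z + h"] \<open>0 \<le> z\<close> assms by simp
  ultimately show "\<exists>d. ((\<lambda>z. f (z + h) - f z) has_real_derivative d) (at z) \<and> 0 < d"
    by blast
qed

end

section \<open>Strict convexity of the logarithm of \<open>g\<close>\<close>

lemma strictly_increasing_deriv_sum_ln_Gamma:
  fixes c :: "'a \<Rightarrow> 'b \<Rightarrow> real"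
  assumes "finite I" "finite J" "I \<noteq> {}" "J \<noteq> {}"
    and pos: "\<And>i j. i \<in> I \<Longrightarrow> j \<in> J \<Longrightarrow> 0 < c i j"
  defines "a \<equiv> (\<lambda>i. \<Sum>j\<in>J. c i j)" and "b \<equiv> (\<lambda>j. \<Sum>i\<in>I. c i j)"
  shows "strictly_increasing_deriv
    (\<lambda>u. (\<Sum>i\<in>I. ln_Gamma (a i * u + 1)) + (\<Sum>j\<in>J. ln_Gamma (b j * u + 1))
       - (\<Sum>i\<in>I. \<Sum>j\<in>J. ln_Gamma (c i j * u + 1)))
    (\<lambda>u. (\<Sum>i\<in>I. a i * Digamma (a i * u + 1)) + (\<Sum>j\<in>J. b j * Digamma (b j * u + 1))
       - (\<Sum>i\<in>I. \<Sum>j\<in>J. c i j * Digamma (c i j * u + 1)))"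
    (is "strictly_increasing_deriv ?f ?f'")
proof
  have a_pos: "0 < a i" if "i \<in> I" for i
    unfolding a_def using assms that by (intro sum_pos) auto
  have b_pos: "0 < b j" if "j \<in> J" for j
    unfolding b_def using assms that by (intro sum_pos) auto
  have D1: "((\<lambda>u. ln_Gamma (d * u + 1)) has_real_derivative d * Digamma (d * u + 1)) (at u)"
    and D2: "((\<lambda>u. d * Digamma (d * u + 1)) has_real_derivative d\<^sup>2 * Polygamma 1 (d * u + 1)) (at u)"
    and P: "0 < Polygamma 1 (d * u + 1)"
    if "0 < d" "0 \<le> u" for d u :: real
  proof -
    have p: "0 < d * u + 1" using that by (simp add: add_nonneg_pos)
    then have np: "d * u + 1 \<notin> \<int>\<^sub>\<le>\<^sub>0" by (auto elim!: nonpos_Ints_cases)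
    show "((\<lambda>u. ln_Gamma (d * u + 1)) has_real_derivative d * Digamma (d * u + 1)) (at u)"
      using p by (auto intro!: derivative_eq_intros)
    show "((\<lambda>u. d * Digamma (d * u + 1)) has_real_derivative d\<^sup>2 * Polygamma 1 (d * u + 1)) (at u)"
      using np by (auto intro!: derivative_eq_intros simp: power2_eq_square)
    show "0 < Polygamma 1 (d * u + 1)"
      using np by (intro Polygamma_real_odd_pos) auto
  qed
  show "(?f has_real_derivative ?f' x) (at x)" if "0 \<le> x" for x
    using that by (intro DERIV_add DERIV_diff DERIV_sum D1 a_pos b_pos pos)
  show "?f' x < ?f' y" if "0 \<le> x" "x < y" for x y
  proof (rule DERIV_pos_imp_increasing[OF \<open>x < y\<close>])
    fix u assume "x \<le> u" "u \<le> y"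
    then have u: "0 \<le> u" using that by simp
    let ?d = "(\<Sum>i\<in>I. (a i)\<^sup>2 * Polygamma 1 (a i * u + 1)) + (\<Sum>j\<in>J. (b j)\<^sup>2 * Polygamma 1 (b j * u + 1))
       - (\<Sum>i\<in>I. \<Sum>j\<in>J. (c i j)\<^sup>2 * Polygamma 1 (c i j * u + 1))"
    have "(?f' has_real_derivative ?d) (at u)"
      using u by (intro DERIV_add DERIV_diff DERIV_sum D2 a_pos b_pos pos)
    \<comment> \<open>One application per row \<open>i\<close>, whose entries \<open>c i j\<close>
      have total \<open>a i\<close>.\<close>
    moreover have "(\<Sum>i\<in>I. \<Sum>j\<in>J. (c i j)\<^sup>2 * Polygamma 1 (c i j * u + 1))
        \<le> (\<Sum>i\<in>I. (a i)\<^sup>2 * Polygamma 1 (a i * u + 1))"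
      unfolding a_def using assms u
      by (intro sum_mono sum_square_mult_Polygamma_1_le) (auto simp: less_imp_le)
    \<comment> \<open>The column terms are left over and make the second derivative strictly
      positive.\<close>
    moreover have "0 < (\<Sum>j\<in>J. (b j)\<^sup>2 * Polygamma 1 (b j * u + 1))"
      using assms u b_pos P by (intro sum_pos mult_pos_pos) (auto simp: less_imp_neq[symmetric])
    ultimately show "\<exists>d. (?f' has_real_derivative d) (at u) \<and> 0 < d"
      by (intro exI[of _ ?d] conjI) auto
  qed
qed

section \<open>Multinomial coefficients as quotients of Gamma values\<close>

lemma gmultinomial_map_upt:
  "gmultinomial x (map f [1..<Suc n]) = Gamma (x + 1) / (\<Prod>j=1..n. Gamma (f j + 1))"
proof -
  have "(\<Prod>y\<leftarrow>map f [1..<Suc n]. Gamma (y + 1)) = (\<Prod>j\<leftarrow>[1..<Suc n]. Gamma (f j + 1))"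
    by (simp add: o_def del: upt_Suc)
  also have "\<dots> = (\<Prod>j\<in>set [1..<Suc n]. Gamma (f j + 1))"
    by (rule prod.distinct_set_conv_list[symmetric]) simp
  also have "set [1..<Suc n] = {1..n}" by auto
  finally show ?thesis by (simp add: gmultinomial_def)
qed

lemma gmultinomial_replicate:
  "gmultinomial x (replicate n y) = Gamma (x + 1) / Gamma (y + 1) ^ n"
  by (simp add: gmultinomial_def)

lemma gmultinomial_pair:
  "gmultinomial x [y, z] = Gamma (x + 1) / (Gamma (y + 1) * Gamma (z + 1))"
  by (simp add: gmultinomial_def)

section \<open>The inequalities for \<open>g\<close>, followed by their multinomial forms\<close>

theorem corollary2p2:
  fixes m n \<nu> :: nat
    and \<alpha> \<beta> :: "nat \<Rightarrow> real"
    and \<Lambda> :: "nat \<Rightarrow> nat \<Rightarrow> real"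
    and g :: "real \<Rightarrow> real"
    and t \<mu> :: "nat \<Rightarrow> real"
  assumes "m \<ge> 1" and "n \<ge> 1"
    and "\<And>i. i \<in> {1..m} \<Longrightarrow> 0 < \<alpha> i \<and> \<alpha> i \<le> 1"
    and "\<And>j. j \<in> {1..n} \<Longrightarrow> 0 < \<beta> j \<and> \<beta> j \<le> 1"
    and "\<And>i j. i \<in> {1..m} \<Longrightarrow> j \<in> {1..n} \<Longrightarrow> 0 < \<Lambda> i j \<and> \<Lambda> i j \<le> 1"
    and "\<And>i. i \<in> {1..m} \<Longrightarrow> (\<Sum>j=1..n. \<Lambda> i j) = \<alpha> i"
    and "\<And>j. j \<in> {1..n} \<Longrightarrow> (\<Sum>i=1..m. \<Lambda> i j) = \<beta> j"
    and "(\<Sum>i=1..m. \<Sum>j=1..n. \<Lambda> i j) = (\<Sum>i=1..m. \<alpha> i)"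
    and "(\<Sum>i=1..m. \<alpha> i) = (\<Sum>j=1..n. \<beta> j)"
    and "(\<Sum>j=1..n. \<beta> j) \<le> 1"
    and g_eq: "g = (\<lambda>u. (\<Prod>i=1..m. Gamma (\<alpha> i * u + 1)) * (\<Prod>j=1..n. Gamma (\<beta> j * u + 1))
                      / (\<Prod>i=1..m. \<Prod>j=1..n. Gamma (\<Lambda> i j * u + 1)))"
    and "\<nu> \<ge> 1"
    and "\<And>k. k \<in> {1..\<nu>} \<Longrightarrow> 0 < t k"
    and "\<And>k. k \<in> {1..\<nu>} \<Longrightarrow> 0 < \<mu> k \<and> \<mu> k < 1"
    and "(\<Sum>k=1..\<nu>. \<mu> k) = 1"
  shows
    \<comment> \<open>(a)\<close>
    "(g (\<Sum>k=1..\<nu>. \<mu> k * t k) \<le> (\<Prod>k=1..\<nu>. g (t k) powr \<mu> k)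
      \<and> (g (\<Sum>k=1..\<nu>. \<mu> k * t k) = (\<Prod>k=1..\<nu>. g (t k) powr \<mu> k)
          \<longleftrightarrow> (\<forall>k\<in>{1..\<nu>}. \<forall>l\<in>{1..\<nu>}. t k = t l)))
    \<and> \<comment> \<open>(b)\<close>
     (\<Prod>k=1..\<nu>. g (t k)) < g (\<Sum>k=1..\<nu>. t k)
    \<and> \<comment> \<open>(c)\<close>
     (\<nu> \<ge> 3 \<and> t 1 \<le> t 3 \<longrightarrow>
        g (t 1 + t 2) * g (t 3) \<le> g (t 1) * g (t 2 + t 3)
        \<and> (g (t 1 + t 2) * g (t 3) = g (t 1) * g (t 2 + t 3) \<longleftrightarrow> t 1 = t 3))
    \<and> \<comment> \<open>(a')\<close>
     ((\<forall>k\<in>{1..\<nu>}. \<mu> k = 1 / real \<nu>) \<longrightarrow>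
       (let tbar = 1 / real \<nu> * (\<Sum>k=1..\<nu>. t k);
            lhs = (\<Prod>i=1..m. gmultinomial (\<alpha> i * tbar) (map (\<lambda>j. \<Lambda> i j * tbar) [1..<Suc n]))
                * (\<Prod>j=1..n. gmultinomial (\<beta> j * tbar) (map (\<lambda>i. \<Lambda> i j * tbar) [1..<Suc m]))
                * (\<Prod>i=1..m. \<Prod>j=1..n. gmultinomial (\<Lambda> i j * tbar)
                      (map (\<lambda>k. \<Lambda> i j * (t k / real \<nu>)) [1..<Suc \<nu>]));
            rhs = (\<Prod>k=1..\<nu>.
                ((\<Prod>i=1..m. gmultinomial (\<alpha> i * t k) (map (\<lambda>j. \<Lambda> i j * t k) [1..<Suc n]))
                * (\<Prod>j=1..n. gmultinomial (\<beta> j * t k) (map (\<lambda>i. \<Lambda> i j * t k) [1..<Suc m]))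
                * (\<Prod>i=1..m. \<Prod>j=1..n. gmultinomial (\<Lambda> i j * t k)
                      (replicate \<nu> (\<Lambda> i j * (t k / real \<nu>))))) powr (1 / real \<nu>))
        in lhs \<le> rhs \<and> (lhs = rhs \<longleftrightarrow> (\<forall>k\<in>{1..\<nu>}. \<forall>l\<in>{1..\<nu>}. t k = t l))))
    \<and> \<comment> \<open>(b')\<close>
     (let T = (\<Sum>k=1..\<nu>. t k)
      in (\<Prod>k=1..\<nu>.
            (\<Prod>i=1..m. gmultinomial (\<alpha> i * t k) (map (\<lambda>j. \<Lambda> i j * t k) [1..<Suc n]))
            * (\<Prod>j=1..n. gmultinomial (\<beta> j * t k) (map (\<lambda>i. \<Lambda> i j * t k) [1..<Suc m])))
         \<le> (\<Prod>i=1..m. gmultinomial (\<alpha> i * T) (map (\<lambda>j. \<Lambda> i j * T) [1..<Suc n]))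
            * (\<Prod>j=1..n. gmultinomial (\<beta> j * T) (map (\<lambda>i. \<Lambda> i j * T) [1..<Suc m]))
            * (\<Prod>i=1..m. \<Prod>j=1..n. gmultinomial (\<Lambda> i j * T)
                  (map (\<lambda>k. \<Lambda> i j * t k) [1..<Suc \<nu>])))
    \<and> \<comment> \<open>(c')\<close>
     (\<nu> \<ge> 3 \<and> t 1 \<le> t 3 \<longrightarrow>
       (let lhs =
              (\<Prod>i=1..m.
                  gmultinomial (\<alpha> i * (t 1 + t 2)) (map (\<lambda>j. \<Lambda> i j * (t 1 + t 2)) [1..<Suc n])
                  * gmultinomial (\<alpha> i * t 3) (map (\<lambda>j. \<Lambda> i j * t 3) [1..<Suc n]))
              * (\<Prod>j=1..n.
                  gmultinomial (\<beta> j * (t 1 + t 2)) (map (\<lambda>i. \<Lambda> i j * (t 1 + t 2)) [1..<Suc m])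
                  * gmultinomial (\<beta> j * t 3) (map (\<lambda>i. \<Lambda> i j * t 3) [1..<Suc m]))
              * (\<Prod>i=1..m. \<Prod>j=1..n. gmultinomial (\<Lambda> i j * (t 1 + t 2 + t 3))
                    [\<Lambda> i j * t 1, \<Lambda> i j * (t 2 + t 3)]);
            rhs =
              (\<Prod>i=1..m.
                  gmultinomial (\<alpha> i * t 1) (map (\<lambda>j. \<Lambda> i j * t 1) [1..<Suc n])
                  * gmultinomial (\<alpha> i * (t 2 + t 3)) (map (\<lambda>j. \<Lambda> i j * (t 2 + t 3)) [1..<Suc n]))
              * (\<Prod>j=1..n.
                  gmultinomial (\<beta> j * t 1) (map (\<lambda>i. \<Lambda> i j * t 1) [1..<Suc m])
                  * gmultinomial (\<beta> j * (t 2 + t 3)) (map (\<lambda>i. \<Lambda> i j * (t 2 + t 3)) [1..<Suc m]))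
              * (\<Prod>i=1..m. \<Prod>j=1..n. gmultinomial (\<Lambda> i j * (t 1 + t 2 + t 3))
                    [\<Lambda> i j * (t 1 + t 2), \<Lambda> i j * t 3])
        in lhs \<le> rhs \<and> (lhs = rhs \<longleftrightarrow> t 1 = t 3)))"
  (is "?A \<and> ?B \<and> ?C \<and> (_ \<longrightarrow> ?A') \<and> ?B' \<and> (_ \<longrightarrow> ?C')")
proof -
  note \<alpha>_pos = assms(3) and \<beta>_pos = assms(4) and \<Lambda>_pos = assms(5)
    and t_pos = assms(13) and \<mu>_bounds = assms(14)
  define f where "f = (\<lambda>u. (\<Sum>i=1..m. ln_Gamma (\<alpha> i * u + 1)) + (\<Sum>j=1..n. ln_Gamma (\<beta> j * u + 1))
       - (\<Sum>i=1..m. \<Sum>j=1..n. ln_Gamma (\<Lambda> i j * u + 1)))"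
  define f' where "f' = (\<lambda>u. (\<Sum>i=1..m. \<alpha> i * Digamma (\<alpha> i * u + 1))
       + (\<Sum>j=1..n. \<beta> j * Digamma (\<beta> j * u + 1))
       - (\<Sum>i=1..m. \<Sum>j=1..n. \<Lambda> i j * Digamma (\<Lambda> i j * u + 1)))"
  \<comment> \<open>\<open>\<alpha>\<close> and \<open>\<beta>\<close> are the row and column sums
    of \<open>\<Lambda>\<close>, so the general convexity lemma speaks of \<open>f\<close>
    itself.\<close>
  interpret strictly_increasing_deriv f f'
    using strictly_increasing_deriv_sum_ln_Gamma[of "{1..m}" "{1..n}" \<Lambda>] \<Lambda>_pos assms(1,2,6,7)
    unfolding f_def f'_def by simp
  have f0: "f 0 = 0"
    by (simp add: f_def ln_Gamma_real_pos)
  have g_exp: "g u = exp (f u)" if "0 \<le> u" for u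
  proof -
    have Gamma_exp: "Gamma (d * u + 1) = exp (ln_Gamma (d * u + 1))" if "0 < d" for d :: real
      using that \<open>0 \<le> u\<close> by (intro Gamma_real_pos_exp) (simp add: add_nonneg_pos)
    show ?thesis
      using \<alpha>_pos \<beta>_pos \<Lambda>_pos
      by (simp add: g_eq f_def exp_add exp_diff exp_sum Gamma_exp)
  qed
  then have g_pos: "0 < g u" if "0 \<le> u" for u using that by simp
  \<comment> \<open>A single weight would equal 1, against \<open>\<mu> k < 1\<close>. Strictness in
    (b) rests on this: for one point both sides agree.\<close>
  have \<nu>2: "2 \<le> \<nu>"
  proof (rule ccontr)
    assume "\<not> 2 \<le> \<nu>"
    with \<open>1 \<le> \<nu>\<close> have "\<nu> = 1" by simp
    with assms(15) \<mu>_bounds[of 1] show False by simp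
  qed
  have T_nonneg: "0 \<le> (\<Sum>k=1..\<nu>. t k)"
    using t_pos by (intro sum_nonneg) (auto simp: less_imp_le)

  have A: ?A
  proof -
    have "0 \<le> (\<Sum>k=1..\<nu>. \<mu> k * t k)"
      using t_pos \<mu>_bounds by (intro sum_nonneg) (auto simp: less_imp_le)
    moreover have "(\<Prod>k=1..\<nu>. g (t k) powr \<mu> k) = exp (\<Sum>k=1..\<nu>. \<mu> k * f (t k))"
      unfolding exp_sum[OF finite_atLeastAtMost]
      using t_pos by (intro prod.cong) (auto simp: g_exp powr_def less_imp_le)
    ultimately show ?thesis
      using jensen[of "{1..\<nu>}" \<mu> t] t_pos \<mu>_bounds assms(15) by (simp add: g_exp less_imp_le)
  qed

  have B: ?B
  proof -
    have "(\<Prod>k=1..\<nu>. g (t k)) = exp (\<Sum>k=1..\<nu>. f (t k))"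
      using t_pos by (simp add: g_exp exp_sum less_imp_le)
    then show ?thesis
      using sum_less[OF f0, of "{1..\<nu>}" t] t_pos \<nu>2 T_nonneg by (simp add: g_exp)
  qed

  have C: "g (t 1 + t 2) * g (t 3) \<le> g (t 1) * g (t 2 + t 3)
        \<and> (g (t 1 + t 2) * g (t 3) = g (t 1) * g (t 2 + t 3) \<longleftrightarrow> t 1 = t 3)"
    if "\<nu> \<ge> 3 \<and> t 1 \<le> t 3"
  proof -
    have t: "0 < t 1" "0 < t 2" "0 < t 3" using that t_pos by auto
    show ?thesis
    proof (cases "t 1 = t 3")
      case True
      then show ?thesis by (simp add: add.commute mult.commute)
    next
      case False
      \<comment> \<open>The increments of length \<open>t 2\<close> starting at \<open>t 1\<close>
        and at \<open>t 3\<close> are compared.\<close>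
      then have "f (t 1 + t 2) + f (t 3) < f (t 1) + f (t 2 + t 3)"
        using increment_less[of "t 1" "t 3" "t 2"] that t by (simp add: add.commute)
      then have "g (t 1 + t 2) * g (t 3) < g (t 1) * g (t 2 + t 3)"
        using t by (simp add: g_exp exp_add[symmetric])
      with False show ?thesis by simp
    qed
  qed

  \<comment> \<open>Passage from \<open>g\<close> to multinomial coefficients\<close>
  define H where "H = (\<lambda>u. \<Prod>i=1..m. \<Prod>j=1..n. Gamma (\<Lambda> i j * u + 1))"
  have H_pos: "0 < H u" if "0 \<le> u" for u
    unfolding H_def using \<Lambda>_pos that
    by (intro prod_pos Gamma_real_pos add_nonneg_pos) (auto simp: less_imp_le)
  \<comment> \<open>Rows and columns each put a factor \<open>H u\<close> in the denominator, the
    columns after swapping the products; one of the two belongs to \<open>g u\<close>.\<close>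
  have margins: "(\<Prod>i=1..m. gmultinomial (\<alpha> i * u) (map (\<lambda>j. \<Lambda> i j * u) [1..<Suc n]))
      * (\<Prod>j=1..n. gmultinomial (\<beta> j * u) (map (\<lambda>i. \<Lambda> i j * u) [1..<Suc m])) = g u / H u" for u
    unfolding gmultinomial_map_upt prod_dividef g_eq H_def
    by (subst (2) prod.swap) simp
  have map_entries: "(\<Prod>i=1..m. \<Prod>j=1..n. gmultinomial (\<Lambda> i j * u) (map (\<lambda>k. \<Lambda> i j * x k) [1..<Suc \<nu>]))
      = H u / (\<Prod>k=1..\<nu>. H (x k))" for u x
  proof -
    have "(\<Prod>i=1..m. \<Prod>j=1..n. \<Prod>k=1..\<nu>. Gamma (\<Lambda> i j * x k + 1))
        = (\<Prod>i=1..m. \<Prod>k=1..\<nu>. \<Prod>j=1..n. Gamma (\<Lambda> i j * x k + 1))"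
      by (intro prod.cong refl prod.swap)
    also have "\<dots> = (\<Prod>k=1..\<nu>. H (x k))"
      unfolding H_def by (rule prod.swap)
    finally show ?thesis
      unfolding gmultinomial_map_upt prod_dividef H_def by simp
  qed
  have replicate_entries: "(\<Prod>i=1..m. \<Prod>j=1..n. gmultinomial (\<Lambda> i j * u) (replicate \<nu> (\<Lambda> i j * x)))
      = H u / H x ^ \<nu>" for u x
    unfolding gmultinomial_replicate prod_dividef H_def by (simp add: prod_power_distrib)
  have pair_entries: "(\<Prod>i=1..m. \<Prod>j=1..n. gmultinomial (\<Lambda> i j * u) [\<Lambda> i j * x, \<Lambda> i j * y])
      = H u / (H x * H y)" for u x y
    unfolding gmultinomial_pair prod_dividef H_def by (simp add: prod.distrib)

  have A': ?A' if \<mu>: "\<forall>k\<in>{1..\<nu>}. \<mu> k = 1 / real \<nu>"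
  proof -
    \<comment> \<open>\<open>K\<close> is the denominator common to both sides:
      \<open>H tbar\<close> cancels on the left, \<open>H (t k)\<close> on the right, and the
      exponent \<open>1 / real \<nu>\<close> undoes the power of
      \<open>H (t k / real \<nu>)\<close>.\<close>
    define K where "K = (\<Prod>k=1..\<nu>. H (t k / real \<nu>))"
    have K: "0 < K"
      unfolding K_def using t_pos by (intro prod_pos H_pos) (auto simp: less_imp_le)
    define tbar where "tbar = 1 / real \<nu> * (\<Sum>k=1..\<nu>. t k)"
    have tbar: "0 \<le> tbar" "tbar = (\<Sum>k=1..\<nu>. \<mu> k * t k)"
    proof -
      show "0 \<le> tbar" unfolding tbar_def using T_nonneg by (intro mult_nonneg_nonneg) auto
      show "tbar = (\<Sum>k=1..\<nu>. \<mu> k * t k)"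
        unfolding tbar_def sum_distrib_left using \<mu> by (intro sum.cong) auto
    qed
    have lhs: "g tbar / H tbar * (H tbar / K) = g tbar / K"
      using H_pos[OF tbar(1)] by simp
    have "(g (t k) / H (t k) * (H (t k) / H (t k / real \<nu>) ^ \<nu>)) powr (1 / real \<nu>)
        = g (t k) powr \<mu> k / H (t k / real \<nu>)" if "k \<in> {1..\<nu>}" for k
    proof -
      have k: "0 \<le> t k" "0 \<le> t k / real \<nu>" using t_pos[OF that] by simp_all
      have "(H (t k / real \<nu>) ^ \<nu>) powr (1 / real \<nu>) = H (t k / real \<nu>)"
        using H_pos[OF k(2)] \<nu>2 by (simp add: powr_realpow[symmetric] powr_powr)
      then show ?thesis
        using \<mu> that H_pos[OF k(1)] H_pos[OF k(2)] g_pos[OF k(1)] by (simp add: powr_divide)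
    qed
    then have rhs: "(\<Prod>k=1..\<nu>. (g (t k) / H (t k) * (H (t k) / H (t k / real \<nu>) ^ \<nu>)) powr (1 / real \<nu>))
        = (\<Prod>k=1..\<nu>. g (t k) powr \<mu> k) / K"
      by (simp add: K_def prod_dividef)
    show ?thesis
      unfolding Let_def margins map_entries replicate_entries tbar_def[symmetric] K_def[symmetric] lhs rhs
      using A K unfolding tbar(2)[symmetric] by (simp add: divide_le_cancel)
  qed

  have B': ?B'
  proof -
    define T where "T = (\<Sum>k=1..\<nu>. t k)"
    have K: "0 < (\<Prod>k=1..\<nu>. H (t k))"
      using t_pos by (intro prod_pos H_pos) (auto simp: less_imp_le)
    have "0 < H T" using T_nonneg by (simp add: T_def H_pos)
    \<comment> \<open>Once \<open>H T\<close> cancels, (b') is (b) divided by a common positive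
      product.\<close>
    then have rhs: "g T / H T * (H T / (\<Prod>k=1..\<nu>. H (t k))) = g T / (\<Prod>k=1..\<nu>. H (t k))" by simp
    show ?thesis
      unfolding Let_def margins map_entries prod_dividef T_def[symmetric] rhs
      using B K by (intro divide_right_mono) (simp_all only: T_def less_imp_le)
  qed

  have C': ?C' if hyp: "\<nu> \<ge> 3 \<and> t 1 \<le> t 3"
  proof -
    have t: "0 < t 1" "0 < t 2" "0 < t 3" using that t_pos by auto
    have margins_pair: "(\<Prod>i=1..m. gmultinomial (\<alpha> i * u) (map (\<lambda>j. \<Lambda> i j * u) [1..<Suc n])
            * gmultinomial (\<alpha> i * v) (map (\<lambda>j. \<Lambda> i j * v) [1..<Suc n]))
        * (\<Prod>j=1..n. gmultinomial (\<beta> j * u) (map (\<lambda>i. \<Lambda> i j * u) [1..<Suc m])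
            * gmultinomial (\<beta> j * v) (map (\<lambda>i. \<Lambda> i j * v) [1..<Suc m]))
        = g u / H u * (g v / H v)" for u v
      unfolding margins[symmetric] prod.distrib by (simp only: mult_ac)
    \<comment> \<open>On each side the margins supply two factors of \<open>K\<close> and the
      two-entry coefficients the other two, with the pairs exchanged between the sides; both sides
      thus carry the factor \<open>S / K\<close>.\<close>
    define K where "K = H (t 1 + t 2) * H (t 3) * H (t 1) * H (t 2 + t 3)"
    define S where "S = H (t 1 + t 2 + t 3)"
    have pos: "0 < S" "0 < K" "0 < H (t 1 + t 2)" "0 < H (t 3)" "0 < H (t 1)" "0 < H (t 2 + t 3)"
      using t by (simp_all add: S_def K_def H_pos)
    have lhs: "g (t 1 + t 2) / H (t 1 + t 2) * (g (t 3) / H (t 3)) * (S / (H (t 1) * H (t 2 + t 3)))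
        = g (t 1 + t 2) * g (t 3) * (S / K)"
      by (simp add: K_def)
    have rhs: "g (t 1) / H (t 1) * (g (t 2 + t 3) / H (t 2 + t 3)) * (S / (H (t 1 + t 2) * H (t 3)))
        = g (t 1) * g (t 2 + t 3) * (S / K)"
      by (simp add: K_def mult_ac)
    have "0 < S / K" using pos by simp
    then show ?thesis
      unfolding Let_def margins_pair pair_entries S_def[symmetric] lhs rhs
      using C[OF hyp] by (simp only: mult_le_cancel_right mult_cancel_right) auto
  qed

  show ?thesis
    using A B C A' B' C' by blast
qed

end
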